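(* Let $L_B$ be a real random variable with density $f_{L_B}(u)=\frac{\pi}{2}\operatorname{sech}^2(\pi u)$, $u\in\mathbb{R}$. Then $$\log\sin\frac{\pi\mathfrak{B}}{2}:=E\log\sin\left(\frac{\pi}{2}\left(-\tfrac12+\imath L_B\right)\right)=\frac12-\log2.$$
   Context: $\imath$ is the imaginary unit and $\log$ is the principal branch of the complex logarithm. $E$ denotes expectation: $E\,g(L_B)=\int_{\mathbb{R}}g(u)\,\frac{\pi}{2}\operatorname{sech}^2(\pi u)\,du$. For the Bernoulli umbra $\mathfrak{B}=\mathfrak{B}(0)$, the nonlinear function $h(\mathfrak{B})$ is understood as $E\,h(-\frac12+\imath L_B)$, here with $h(u)=\log\sin\frac{\pi u}{2}$. *)

theory Defs
  imports "HOL-Probability.Probability"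
begin

definition sech :: "real \<Rightarrow> real" where
  "sech x = 1 / cosh x"

definition LB_density :: "real \<Rightarrow> real" where
  "LB_density u = pi / 2 * (sech (pi * u))\<^sup>2"

text \<open>Umbral evaluation of a function \<open>h\<close> at the Bernoulli umbra \<open>\<BB> = -1/2 + \<i> L\<close>, where
  \<open>L\<close> has density \<^const>\<open>LB_density\<close>.\<close>

definition bernoulli_umbra_eval :: "(complex \<Rightarrow> complex) \<Rightarrow> complex" where
  "bernoulli_umbra_eval h =
     (LINT u|lborel. h (- 1 / 2 + \<i> * complex_of_real u) * complex_of_real (LB_density u))"

definition log_sin_half_pi :: "complex \<Rightarrow> complex" where
  "log_sin_half_pi z = Ln (sin (complex_of_real pi * z / 2))"

end

theory Submission
  imports Defs "HOL-Real_Asymp.Real_Asymp"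
begin

text \<open>
  Write \<open>g u = Ln (sin (\<pi>/2 * (- 1/2 + \<i> * u)))\<close> for real \<open>u\<close>.  The sine equals
  \<open>(- cosh (\<pi> u / 2) + \<i> * sinh (\<pi> u / 2)) / \<surd>2\<close>, and two things follow.

  Its squared modulus is \<open>cosh (\<pi> u) / 2\<close>, so \<open>Re (g u) = (ln (cosh (\<pi> u)) - ln 2) / 2\<close>.  With
  \<open>v = \<pi> u\<close>, the function \<open>tanh v * ln (cosh v) - v + tanh v\<close> is an antiderivative of
  \<open>ln (cosh v) / cosh\<^sup>2 v\<close> with limits \<open>\<plusminus>(1 - ln 2)\<close>; this gives the mean of \<open>Re g\<close>
  (lemma \<open>has_bochner_integral_ln_cosh_LB_density\<close>).

  Its values at \<open>u\<close> and \<open>-u\<close> are complex conjugates.  Its real part is negative, so at \<open>u = 0\<close> the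
  sine crosses the branch cut of the logarithm; away from this null set \<open>g (-u)\<close> is the conjugate
  of \<open>g u\<close>, hence the mean of \<open>g\<close> is real because the density is even.  The mean exists because
  \<open>Re g\<close> is integrable against the density and \<open>\<bar>Im g\<bar> \<le> \<pi>\<close>
  (lemma \<open>has_bochner_integral_log_sin_line\<close>).
\<close>

lemma has_bochner_integral_FTC_nonneg_UNIV:
  fixes f F :: "real \<Rightarrow> real"
  assumes F: "\<And>x. (F has_real_derivative f x) (at x)"
    and f: "\<And>x. isCont f x"
    and nonneg: "\<And>x. 0 \<le> f x"
    and bot: "(F \<longlongrightarrow> A) at_bot" and top: "(F \<longlongrightarrow> B) at_top"
  shows "has_bochner_integral lborel f (B - A)"
proof -
  have A: "((F \<circ> real_of_ereal) \<longlongrightarrow> A) (at_right (- \<infinity>))"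
    and B: "((F \<circ> real_of_ereal) \<longlongrightarrow> B) (at_left \<infinity>)"
    using bot top by (simp_all add: ereal_tendsto_simps)
  have "set_integrable lborel (einterval (- \<infinity>) \<infinity>) f"
    by (rule interval_integral_FTC_nonneg(1)[OF _ _ _ _ A B]) (use F f nonneg in auto)
  moreover have "(LBINT x=-\<infinity>..\<infinity>. f x) = B - A"
    by (rule interval_integral_FTC_nonneg(2)[OF _ _ _ _ A B]) (use F f nonneg in auto)
  ultimately show ?thesis
    by (simp add: has_bochner_integral_iff set_integrable_def interval_lebesgue_integral_def
        set_lebesgue_integral_def)
qed

lemma LB_density_eq: "LB_density u = pi / 2 * (1 - (tanh (pi * u))\<^sup>2)"
proof -
  have "(cosh (pi * u))\<^sup>2 - (sinh (pi * u))\<^sup>2 = 1" by (simp add: cosh_square_eq)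
  moreover have "(cosh (pi * u))\<^sup>2 \<noteq> 0" by simp
  ultimately show ?thesis
    unfolding LB_density_def sech_def tanh_def power_divide by (simp add: field_simps)
qed

lemma LB_density_nonneg: "0 \<le> LB_density u"
  by (simp add: LB_density_def)

lemma LB_density_minus: "LB_density (- u) = LB_density u"
  by (simp add: LB_density_eq)

lemma isCont_LB_density: "isCont LB_density u"
  unfolding LB_density_eq[abs_def] by (intro continuous_intros) auto

lemma borel_measurable_LB_density [measurable]: "LB_density \<in> borel_measurable borel"
  using isCont_LB_density by (intro borel_measurable_continuous_onI) (simp add: continuous_on_eq_continuous_at)

lemma has_bochner_integral_LB_density: "has_bochner_integral lborel LB_density 1"
proof -
  define F :: "real \<Rightarrow> real" where "F u = tanh (pi * u) / 2" for u
  have "has_bochner_integral lborel LB_density (1/2 - (- (1/2)))"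
  proof (rule has_bochner_integral_FTC_nonneg_UNIV)
    show "(F has_real_derivative LB_density u) (at u)" for u
      unfolding F_def LB_density_eq by (auto intro!: derivative_eq_intros)
    show top: "(F \<longlongrightarrow> 1/2) at_top"
      unfolding F_def by real_asymp
    show "(F \<longlongrightarrow> - (1/2)) at_bot"
      using tendsto_minus[OF top] by (subst filterlim_at_bot_mirror) (simp add: F_def)
  qed (use isCont_LB_density LB_density_nonneg in auto)
  thus ?thesis by simp
qed

lemma has_bochner_integral_ln_cosh_LB_density:
  "has_bochner_integral lborel (\<lambda>u. ln (cosh (pi * u)) * LB_density u) (1 - ln 2)"
proof -
  define F :: "real \<Rightarrow> real" where
    "F u = (tanh (pi * u) * ln (cosh (pi * u)) - pi * u + tanh (pi * u)) / 2" for u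
  have "has_bochner_integral lborel (\<lambda>u. ln (cosh (pi * u)) * LB_density u)
          ((1 - ln 2) / 2 - (- ((1 - ln 2) / 2)))"
  proof (rule has_bochner_integral_FTC_nonneg_UNIV)
    have pos: "cosh (pi * u) > 0" for u by simp
    show "(F has_real_derivative ln (cosh (pi * u)) * LB_density u) (at u)" for u
      unfolding F_def LB_density_eq
      by (auto intro!: derivative_eq_intros simp: tanh_def field_simps power2_eq_square)
    show "isCont (\<lambda>u. ln (cosh (pi * u)) * LB_density u) u" for u
      using isCont_LB_density by (intro continuous_intros) auto
    show "0 \<le> ln (cosh (pi * u)) * LB_density u" for u
      using LB_density_nonneg cosh_real_ge_1[of "pi * u"] by simp
    show top: "(F \<longlongrightarrow> (1 - ln 2) / 2) at_top"
    proof -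
      \<comment> \<open>Write \<open>ln (cosh v) = v + ln (1 + exp (- 2 * v)) - ln 2\<close> to cancel the linear terms.\<close>
      have F_eq: "F u = (- (2 * (pi * u) * exp (- 2 * (pi * u)) / (1 + exp (- 2 * (pi * u))))
                   + tanh (pi * u) * (ln (1 + exp (- 2 * (pi * u))) - ln 2 + 1)) / 2" for u
      proof -
        let ?v = "pi * u" and ?e = "exp (- 2 * (pi * u))"
        have e: "1 + ?e > 0" by (intro add_pos_pos) auto
        have "cosh ?v = exp ?v * (1 + ?e) / 2"
          by (simp add: cosh_field_def algebra_simps flip: exp_add)
        hence "ln (cosh ?v) = ln (exp ?v * (1 + ?e) / 2)"
          by (rule arg_cong)
        also have "\<dots> = ?v + ln (1 + ?e) - ln 2"
          using e by (simp add: ln_mult ln_div)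
        finally have ln_cosh: "ln (cosh ?v) = ?v + ln (1 + ?e) - ln 2" .
        have linear: "tanh ?v * ?v - ?v = - (2 * ?v * ?e / (1 + ?e))"
          using e unfolding tanh_real_altdef by (simp add: field_simps)
        show ?thesis
          unfolding F_def ln_cosh linear[symmetric] by (simp add: algebra_simps)
      qed
      have lim1: "((\<lambda>u. 2 * (pi * u) * exp (- 2 * (pi * u)) / (1 + exp (- 2 * (pi * u)))) \<longlongrightarrow> 0) at_top"
        by real_asymp
      have lim2: "((\<lambda>u. tanh (pi * u)) \<longlongrightarrow> 1) at_top"
        by real_asymp
      have lim3: "((\<lambda>u. ln (1 + exp (- 2 * (pi * u)))) \<longlongrightarrow> 0) at_top"
        by real_asymp
      have "(F \<longlongrightarrow> (- 0 + 1 * (0 - ln 2 + 1)) / 2) at_top"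
        unfolding F_eq by (intro tendsto_divide tendsto_add tendsto_diff tendsto_mult tendsto_minus
            tendsto_const lim1 lim2 lim3) simp
      thus ?thesis by simp
    qed
    have odd: "F (- u) = - F u" for u
      by (simp add: F_def field_simps)
    show "(F \<longlongrightarrow> - ((1 - ln 2) / 2)) at_bot"
      using tendsto_minus[OF top] by (subst filterlim_at_bot_mirror) (simp add: odd)
  qed
  thus ?thesis by simp
qed

text \<open>
  The value of \<open>log sin (\<pi> z / 2)\<close> at the point \<open>z = - 1/2 + \<i> u\<close>, with the principal branch.
\<close>

definition log_sin_line :: "real \<Rightarrow> complex" where
  "log_sin_line u = Ln (sin (complex_of_real pi / 2 * (- 1 / 2 + \<i> * complex_of_real u)))"

lemma sin_line_eq:
  "sin (complex_of_real pi / 2 * (- 1 / 2 + \<i> * complex_of_real u)) =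
     Complex (- (sqrt 2 / 2 * cosh (pi * u / 2))) (sqrt 2 / 2 * sinh (pi * u / 2))"
proof -
  have "complex_of_real pi / 2 * (- 1 / 2 + \<i> * complex_of_real u) = Complex (- (pi / 4)) (pi * u / 2)"
    by (simp add: complex_eq_iff)
  thus ?thesis
    by (simp add: complex_eq_iff Re_sin Im_sin sin_45 cos_45 cosh_field_def sinh_field_def)
qed

lemma Re_log_sin_line: "Re (log_sin_line u) = (ln (cosh (pi * u)) - ln 2) / 2"
proof -
  let ?w = "Complex (- (sqrt 2 / 2 * cosh (pi * u / 2))) (sqrt 2 / 2 * sinh (pi * u / 2))"
  have "(sqrt 2 / 2 * cosh (pi * u / 2))\<^sup>2 + (sqrt 2 / 2 * sinh (pi * u / 2))\<^sup>2 = cosh (pi * u) / 2"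
    using cosh_double[of "pi * u / 2"] by (simp add: power_mult_distrib power_divide)
  hence "norm ?w = sqrt (cosh (pi * u) / 2)"
    by (simp add: complex_norm)
  moreover have "?w \<noteq> 0" by (simp add: complex_eq_iff)
  ultimately show ?thesis
    unfolding log_sin_line_def sin_line_eq by (simp add: ln_sqrt ln_div)
qed

lemma log_sin_line_minus:
  assumes "u \<noteq> 0"
  shows "log_sin_line (- u) = cnj (log_sin_line u)"
proof -
  have "Complex (- (sqrt 2 / 2 * cosh (pi * u / 2))) (sqrt 2 / 2 * sinh (pi * u / 2)) \<notin> \<real>\<^sub>\<le>\<^sub>0"
    using assms by (simp add: complex_nonpos_Reals_iff)
  from cnj_Ln[OF this] show ?thesis
    unfolding log_sin_line_def sin_line_eq by (simp add: complex_cnj)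
qed

lemma borel_measurable_log_sin_line [measurable]: "log_sin_line \<in> borel_measurable borel"
  \<comment> \<open>The function jumps at \<open>0\<close>, where the sine meets the branch cut, and is continuous elsewhere.\<close>
proof (rule borel_measurable_continuous_countable_exceptions[where X = "{0}"])
  show "continuous_on (- {0}) log_sin_line"
    unfolding log_sin_line_def
  proof (intro continuous_intros)
    show "sin (complex_of_real pi / 2 * (- 1 / 2 + \<i> * complex_of_real u)) \<notin> \<real>\<^sub>\<le>\<^sub>0" if "u \<in> - {0}" for u
      unfolding sin_line_eq using that by (simp add: complex_nonpos_Reals_iff)
  qed
qed simp

lemma has_bochner_integral_log_sin_line:
  "has_bochner_integral lborel (\<lambda>u. LB_density u *\<^sub>R log_sin_line u) (complex_of_real (1 / 2 - ln 2))"
proof -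
  let ?f = "\<lambda>u. LB_density u *\<^sub>R log_sin_line u"
  have "has_bochner_integral lborel
          (\<lambda>u. (ln (cosh (pi * u)) * LB_density u - ln 2 * LB_density u) / 2) ((1 - ln 2 - ln 2 * 1) / 2)"
    by (intro has_bochner_integral_divide_zero has_bochner_integral_diff has_bochner_integral_mult_right
        has_bochner_integral_ln_cosh_LB_density has_bochner_integral_LB_density)
  also have "(\<lambda>u. (ln (cosh (pi * u)) * LB_density u - ln 2 * LB_density u) / 2) = (\<lambda>u. Re (?f u))"
    by (simp add: Re_log_sin_line field_simps fun_eq_iff)
  finally have Re: "has_bochner_integral lborel (\<lambda>u. Re (?f u)) (1 / 2 - ln 2)"
    by (simp add: field_simps)
  have int: "integrable lborel ?f"
  proof (rule Bochner_Integration.integrable_bound)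
    show "integrable lborel (\<lambda>u. \<bar>Re (?f u)\<bar> + pi * LB_density u)"
      using Re has_bochner_integral_LB_density by (auto simp: has_bochner_integral_iff)
    have "\<bar>Im (log_sin_line u)\<bar> \<le> pi" for u
    proof -
      have "sin (complex_of_real pi / 2 * (- 1 / 2 + \<i> * complex_of_real u)) \<noteq> 0"
        unfolding sin_line_eq by (simp add: complex_eq_iff)
      thus ?thesis
        using mpi_less_Im_Ln Im_Ln_le_pi unfolding log_sin_line_def by (smt (verit))
    qed
    hence "\<bar>Im (?f u)\<bar> \<le> pi * LB_density u" for u
      using LB_density_nonneg[of u] by (simp add: abs_mult mult.commute[of pi] mult_left_mono)
    hence "norm (?f u) \<le> norm (\<bar>Re (?f u)\<bar> + pi * LB_density u)" for u
      using cmod_le[of "?f u"] LB_density_nonneg[of u]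
      by (smt (verit) real_norm_def)
    thus "AE u in lborel. norm (?f u) \<le> norm (\<bar>Re (?f u)\<bar> + pi * LB_density u)" by simp
  qed measurable
  \<comment> \<open>The imaginary part vanishes by the reflection \<open>u \<mapsto> -u\<close>; the branch cut is met only at \<open>u = 0\<close>.\<close>
  have "(LINT u|lborel. ?f u) = (LINT u|lborel. ?f (- u))"
    using lborel_integral_real_affine[of "-1" ?f 0] by simp
  also have "\<dots> = (LINT u|lborel. cnj (?f u))"
  proof (rule integral_cong_AE)
    show "AE u in lborel. ?f (- u) = cnj (?f u)"
      using AE_lborel_singleton[of 0] by eventually_elim (simp add: log_sin_line_minus LB_density_minus)
    show "(\<lambda>u. cnj (?f u)) \<in> borel_measurable lborel"
      using int by (intro borel_measurable_integrable) (simp only: complex_integrable_cnj)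
  qed measurable
  also have "\<dots> = cnj (LINT u|lborel. ?f u)"
    by (rule Bochner_Integration.integral_cnj)
  finally have "Im (LINT u|lborel. ?f u) = 0"
    by (simp add: complex_eq_iff)
  moreover have "Re (LINT u|lborel. ?f u) = 1 / 2 - ln 2"
    using Re by (simp only: has_bochner_integral_iff integral_Re[OF int])
  ultimately show ?thesis
    using int by (simp add: has_bochner_integral_iff complex_eq_iff)
qed

theorem mainTheorem6:
  fixes M :: "'a measure" and L :: "'a \<Rightarrow> real"
  assumes "prob_space M"
    and "distributed M lborel L (\<lambda>u. ennreal (LB_density u))"
  shows "integrable M
           (\<lambda>\<omega>. Ln (sin (complex_of_real pi / 2 * (- 1 / 2 + \<i> * complex_of_real (L \<omega>))))) \<and>
         bernoulli_umbra_eval log_sin_half_pi =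
           prob_space.expectation M
             (\<lambda>\<omega>. Ln (sin (complex_of_real pi / 2 * (- 1 / 2 + \<i> * complex_of_real (L \<omega>))))) \<and>
         prob_space.expectation M
             (\<lambda>\<omega>. Ln (sin (complex_of_real pi / 2 * (- 1 / 2 + \<i> * complex_of_real (L \<omega>)))))
         = complex_of_real (1 / 2 - ln 2)"
proof -
  have L: "L \<in> measurable M lborel"
    using assms(2) by (simp add: distributed_def)
  have "has_bochner_integral (density lborel LB_density) log_sin_line (complex_of_real (1 / 2 - ln 2))"
    by (intro has_bochner_integral_density has_bochner_integral_log_sin_line)
       (simp_all add: LB_density_nonneg)
  hence "has_bochner_integral (distr M lborel L) log_sin_line (complex_of_real (1 / 2 - ln 2))"
    using distributed_distr_eq_density[OF assms(2)] by simp
  hence E: "has_bochner_integral M (\<lambda>\<omega>. log_sin_line (L \<omega>)) (complex_of_real (1 / 2 - ln 2))"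
    using integrable_distr_eq[OF L, of log_sin_line] integral_distr[OF L, of log_sin_line]
    by (simp add: has_bochner_integral_iff)
  have "bernoulli_umbra_eval log_sin_half_pi = (LINT u|lborel. LB_density u *\<^sub>R log_sin_line u)"
    by (simp add: bernoulli_umbra_eval_def log_sin_half_pi_def log_sin_line_def scaleR_conv_of_real
        mult.commute)
  also have "\<dots> = complex_of_real (1 / 2 - ln 2)"
    using has_bochner_integral_log_sin_line by (simp add: has_bochner_integral_iff)
  finally show ?thesis
    using E by (simp add: has_bochner_integral_iff log_sin_line_def)
qed

end
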